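(* For each row below and each positive integer $l$ (with $l\ge 2$ in row 9), there exists a partial geometric design with $v=12$ points and the listed parameters $(b,k,r;\alpha,\beta)$ whose concurrence matrix (for a suitable ordering of the points) is the listed $12\times12$ symmetric circulant matrix $C[c_0,c_1,c_2,c_3,c_4,c_5,c_6]$, and whose concurrence matrix has spectrum $[(kr)^1,n^{\sigma},0^{11-\sigma}]$ with $n^\sigma$ as listed: 1. $C[4l,l,l,0,l,l,0]$, $k=3$, $n^\sigma=(4l)^9$, $(b,r;\alpha,\beta)=(16l,4l;2l,6l)$; 2. $C[3l,l,0,l,0,l,3l]$, $k=4$, $(6l)^4$, $(9l,3l;2l,8l)$; 3. $C[5l,l,l,l,l,l,5l]$, $k=4$, $(8l)^5$, $(15l,5l;4l,12l)$; 4. $C[4l,l,l,2l,l,l,0]$, $k=4$, $(4l)^8$, $(12l,4l;4l,8l)$; 5. $C[3l,l,l,l,0,l,l]$, $k=4$, $(3l)^8$, $(9l,3l;3l,6l)$; 6. $C[2l,l,l,0,l,l,2l]$, $k=6$, $(4l)^3$, $(4l,2l;4l,8l)$; 7. $C[3l,l,l,l,3l,l,l]$, $k=6$, $(6l)^3$, $(6l,3l;6l,12l)$; 8. $C[5l,2l,2l,2l,2l,2l,5l]$, $k=6$, $(6l)^5$, $(10l,5l;12l,18l)$; 9. $C[2l,l,l,l,l,l,0]$, $k=6$, $(2l)^6$, $(4l,2l;5l,7l)$, for $l\ge 2$; 10. $C[7l,3l,4l,3l,4l,3l,l]$, $k=6$, $(6l)^7$, $(14l,7l;18l,24l)$; 11.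 $C[6l,3l,3l,2l,3l,3l,2l]$, $k=6$, $(4l)^9$, $(12l,6l;16l,20l)$. In particular there are at least 11 infinite families of $12\times 12$ symmetric integral circulant matrices that are realized as concurrence matrices of partial geometric designs.
   Context: A partial geometric design with parameters $(v,b,k,r;\alpha,\beta)$ is a tactical configuration with $v$ points and $b$ blocks (repeated blocks allowed), each block of size $k$, each point in $r$ blocks, whose $v\times b$ incidence matrix $N$ satisfies $NN^TN=\beta N+\alpha(J-N)$ ($J$ all-ones); its concurrence matrix is $NN^T$, whose $(x,y)$ entry is the number of blocks containing $x$ and $y$. For a $12\times 12$ symmetric circulant matrix, $C[c_0,c_1,c_2,c_3,c_4,c_5,c_6]$ denotes the circulant matrix with first row $[c_0,c_1,c_2,c_3,c_4,c_5,c_6,c_5,c_4,c_3,c_2,c_1]$. Spectra are written with multiplicities as exponents. *)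

theory Defs
  imports
    Complex_Main
    "HOL-Library.Multiset"
    "HOL-Library.Disjoint_Sets"
    "Jordan_Normal_Form.Char_Poly"
begin

text \<open>A configuration is a set of points together with a multiset of blocks (subsets of the
  point set), so that repeated blocks are allowed.\<close>

definition tactical_configuration ::
  "'a set \<Rightarrow> 'a set multiset \<Rightarrow> nat \<Rightarrow> nat \<Rightarrow> nat \<Rightarrow> nat \<Rightarrow> bool" where
  "tactical_configuration V \<B> v b k r \<longleftrightarrow>
     finite V \<and> card V = v \<and> size \<B> = b \<and>
     (\<forall>B \<in># \<B>. B \<subseteq> V \<and> card B = k) \<and>
     (\<forall>x \<in> V. size {#B \<in># \<B>. x \<in> B#} = r)"

definition is_ordering ::
  "'a list \<Rightarrow> 'a set list \<Rightarrow> 'a set \<Rightarrow> 'a set multiset \<Rightarrow> bool" where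
  "is_ordering ps bs V \<B> \<longleftrightarrow> distinct ps \<and> set ps = V \<and> mset bs = \<B>"

definition incidence_matrix :: "'a list \<Rightarrow> 'a set list \<Rightarrow> int mat" where
  "incidence_matrix ps bs =
     mat (length ps) (length bs) (\<lambda>(i, j). if ps ! i \<in> bs ! j then 1 else 0)"

definition concurrence_matrix :: "'a list \<Rightarrow> 'a set list \<Rightarrow> int mat" where
  "concurrence_matrix ps bs = incidence_matrix ps bs * transpose_mat (incidence_matrix ps bs)"

definition all_ones_mat :: "nat \<Rightarrow> nat \<Rightarrow> int mat" where
  "all_ones_mat m n = mat m n (\<lambda>_. 1)"

text \<open>The matrix equation does not depend on how points and blocks are ordered; it is required
  for every ordering.\<close>

definition partial_geometric_design ::
  "'a set \<Rightarrow> 'a set multiset \<Rightarrow> nat \<Rightarrow> nat \<Rightarrow> nat \<Rightarrow> nat \<Rightarrow> nat \<Rightarrow> nat \<Rightarrow> bool" where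
  "partial_geometric_design V \<B> v b k r \<alpha> \<beta> \<longleftrightarrow>
     tactical_configuration V \<B> v b k r \<and>
     (\<forall>ps bs. is_ordering ps bs V \<B> \<longrightarrow>
        (let N = incidence_matrix ps bs in
           N * transpose_mat N * N =
             int \<beta> \<cdot>\<^sub>m N + int \<alpha> \<cdot>\<^sub>m (all_ones_mat v b - N)))"

definition circulant_mat :: "'a list \<Rightarrow> 'a mat" where
  "circulant_mat c =
     (let n = length c in mat n n (\<lambda>(i, j). c ! ((j + n - i) mod n)))"

definition sym_circulant12 ::
  "nat \<Rightarrow> nat \<Rightarrow> nat \<Rightarrow> nat \<Rightarrow> nat \<Rightarrow> nat \<Rightarrow> nat \<Rightarrow> int mat" where
  "sym_circulant12 c0 c1 c2 c3 c4 c5 c6 =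
     circulant_mat (map int [c0, c1, c2, c3, c4, c5, c6, c5, c4, c3, c2, c1])"

definition spectrum_mset :: "int mat \<Rightarrow> complex multiset" where
  "spectrum_mset M = proots (char_poly (map_mat complex_of_int M))"

text \<open>\<open>realized12 M k n \<sigma> b r \<alpha> \<beta>\<close>: some partial geometric design with parameters
  \<open>(12, b, k, r; \<alpha>, \<beta>)\<close> has, for a suitable ordering of its points, concurrence matrix \<open>M\<close>,
  and this matrix has spectrum \<open>[(kr)^1, n^\<sigma>, 0^(11 - \<sigma>)]\<close>.\<close>

definition realized12 ::
  "int mat \<Rightarrow> nat \<Rightarrow> nat \<Rightarrow> nat \<Rightarrow> nat \<Rightarrow> nat \<Rightarrow> nat \<Rightarrow> nat \<Rightarrow> bool" where
  "realized12 M k n \<sigma> b r \<alpha> \<beta> \<longleftrightarrow>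
     (\<exists>(V :: nat set) \<B> ps bs.
        partial_geometric_design V \<B> 12 b k r \<alpha> \<beta> \<and>
        is_ordering ps bs V \<B> \<and>
        concurrence_matrix ps bs = M \<and>
        spectrum_mset (concurrence_matrix ps bs) =
          {#of_nat (k * r)#} + replicate_mset \<sigma> (of_nat n) + replicate_mset (11 - \<sigma>) 0)"

definition is_pgd_concurrence_matrix :: "int mat \<Rightarrow> bool" where
  "is_pgd_concurrence_matrix M \<longleftrightarrow>
     (\<exists>(V :: nat set) \<B> v b k r \<alpha> \<beta> ps bs.
        partial_geometric_design V \<B> v b k r \<alpha> \<beta> \<and>
        is_ordering ps bs V \<B> \<and>
        concurrence_matrix ps bs = M)"

text \<open>``Integral'' is taken in both senses: the entries are integers (by the type of the
  matrix) and so are all eigenvalues.\<close>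

definition sym_integral_circulant :: "nat \<Rightarrow> int mat \<Rightarrow> bool" where
  "sym_integral_circulant n M \<longleftrightarrow>
     M \<in> carrier_mat n n \<and> transpose_mat M = M \<and>
     (\<exists>c. length c = n \<and> M = circulant_mat c) \<and>
     set_mset (spectrum_mset M) \<subseteq> \<int>"

end

theory Submission
  imports Defs
begin

text \<open>Write \<open>M = l C\<close> for the prescribed circulant matrix. Once the concurrence matrix is \<open>M\<close>,
  the equation \<open>N N\<^sup>T N = \<beta> N + \<alpha> (J - N)\<close> is a condition on single blocks that is homogeneous
  in \<open>l\<close>: every block \<open>B\<close> has \<open>\<Sum>y\<in>B. C x y\<close> equal to \<open>\<beta>/l\<close> or \<open>\<alpha>/l\<close> according to whether
  \<open>x \<in> B\<close>. Hence the union of designs for \<open>l\<close> and \<open>l'\<close> is a design for \<open>l + l'\<close>, and one explicit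
  design with \<open>l = 1\<close> suffices for each row; row 9 needs \<open>l = 2\<close> and \<open>l = 3\<close>, where the
  blocks encode six pairwise orthogonal balanced \<open>\<plusminus>1\<close> vectors of length 8 and 12. The spectrum is read off the
  Fourier diagonalisation of circulant matrices.\<close>

section \<open>The spectrum of a circulant matrix\<close>

text \<open>With \<open>w\<close> the primitive root \<open>cis (2 * pi / n)\<close>, this is the
  polynomial with coefficients \<open>c\<close> evaluated at \<open>w ^ k\<close>: the discrete
  Fourier transform of the first row.\<close>

definition circulant_eigenvalue :: "complex list \<Rightarrow> nat \<Rightarrow> complex" where
  "circulant_eigenvalue c k =
     (\<Sum>j<length c. c ! j * cis (2 * pi / length c) ^ (j * k))"

lemma power_mod_root_of_unity:
  fixes z :: "'a :: monoid_mult"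
  assumes "z ^ n = 1"
  shows "z ^ (m mod n) = z ^ m"
proof -
  have "z ^ m = z ^ (n * (m div n) + m mod n)"
    by simp
  also have "\<dots> = z ^ (m mod n)"
    using assms by (simp only: power_add power_mult) simp
  finally show ?thesis ..
qed

lemma cis_root_of_unity: "n > 0 \<Longrightarrow> cis (2 * pi / n) ^ n = 1"
  by (simp add: DeMoivre)

text \<open>The summands are the powers of \<open>z = w ^ k / w ^ m\<close>, an \<open>n\<close>-th
  root of unity that equals 1 only for \<open>k = m\<close>, since both exponents lie below
  \<open>n\<close>. Otherwise the geometric sum vanishes.\<close>

lemma cis_power_orthogonality:
  assumes "k < n" "m < n"
  shows "(\<Sum>j<n. cis (2 * pi / n) ^ (j * k) * inverse (cis (2 * pi / n) ^ (j * m))) =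
    (if k = m then of_nat n else 0)"
proof -
  define w where "w = cis (2 * pi / n)"
  define z where "z = w ^ k / w ^ m"
  have w: "w \<noteq> 0" "w ^ n = 1"
    using assms cis_root_of_unity[of n] by (auto simp: w_def)
  have "w ^ (j * k) * inverse (w ^ (j * m)) = z ^ j" for j
    by (simp add: z_def power_divide field_simps flip: power_mult)
  then have sum: "(\<Sum>j<n. w ^ (j * k) * inverse (w ^ (j * m))) = (\<Sum>j<n. z ^ j)"
    by simp
  show ?thesis
  proof (cases "k = m")
    case True
    then have "z = 1" using w by (simp add: z_def)
    then show ?thesis using sum True by (simp add: w_def)
  next
    case False
    have "inj_on (\<lambda>k. cis (2 * pi * real k / real n)) {..<n}"
      using bij_betw_roots_unity[of n] assms by (auto simp: bij_betw_def)
    then have "cis (2 * pi * real k / real n) \<noteq> cis (2 * pi * real m / real n)"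
      using False assms by (auto dest: inj_onD)
    then have "w ^ k \<noteq> w ^ m"
      by (simp add: w_def DeMoivre mult_ac)
    then have "z \<noteq> 1"
      using w by (simp add: z_def)
    moreover have "z ^ n = 1"
      using w(2) by (metis (no_types) z_def div_by_1 mult.commute power_divide power_mult power_one)
    ultimately have "(\<Sum>j<n. z ^ j) = 0"
      by (simp add: geometric_sum)
    then show ?thesis using sum False by (simp add: w_def)
  qed
qed

section \<open>Diagonalisation of circulant matrices by the Fourier matrix\<close>

lemma circulant_mat_carrier [simp]:
  "circulant_mat c \<in> carrier_mat (length c) (length c)"
  by (simp add: circulant_mat_def Let_def)

lemma circulant_mat_index:
  "i < length c \<Longrightarrow> j < length c \<Longrightarrow>
    circulant_mat c $$ (i, j) = c ! ((j + length c - i) mod length c)"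
  by (simp add: circulant_mat_def Let_def)

lemma map_mat_circulant_mat: "map_mat f (circulant_mat c) = circulant_mat (map f c)"
  by (rule eq_matI) (auto simp: circulant_mat_def Let_def intro!: nth_map[symmetric] mod_less_divisor)

text \<open>Row \<open>i\<close> is row 0 shifted cyclically by \<open>i\<close>. Undoing the shift
  in the summation index pulls out \<open>w ^ (i * k)\<close>, because exponents of
  \<open>w ^ k\<close> matter only modulo \<open>n\<close>.\<close>

lemma circulant_mat_eigenvector:
  assumes "i < length c"
  shows "(\<Sum>j<length c. c ! ((j + length c - i) mod length c) *
      cis (2 * pi / length c) ^ (j * k)) =
    cis (2 * pi / length c) ^ (i * k) * circulant_eigenvalue c k"
proof -
  define n where "n = length c"
  define w where "w = cis (2 * pi / n)"
  have n: "i < n" "n > 0" using assms by (auto simp: n_def)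
  have w: "w ^ n = 1" using n cis_root_of_unity by (simp add: w_def)
  then have wk: "(w ^ k) ^ n = 1"
    by (metis mult.commute power_mult power_one)
  have "(\<Sum>j<n. c ! ((j + n - i) mod n) * w ^ (j * k)) =
      (\<Sum>j<n. c ! j * (w ^ (i * k) * w ^ (j * k)))"
  proof (rule sum.reindex_bij_witness[of _ "\<lambda>j. (j + i) mod n" "\<lambda>j. (j + n - i) mod n"])
    fix j assume j: "j \<in> {..<n}"
    show eq: "((j + n - i) mod n + i) mod n = j"
      using j n by (simp add: mod_add_left_eq)
    show "((j + i) mod n + n - i) mod n = j"
    proof -
      \<comment> \<open>As \<open>i < n\<close>, the truncated subtraction regroups to the addition
        of \<open>n - i\<close>, which lets the inner reduction modulo \<open>n\<close> be
        dropped.\<close>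
      have "((j + i) mod n + n - i) mod n = ((j + i) mod n + (n - i)) mod n"
        using n by simp
      also have "\<dots> = (j + i + (n - i)) mod n"
        by (rule mod_add_left_eq)
      finally show ?thesis using j n by simp
    qed
    have "w ^ (i * k) * w ^ ((j + n - i) mod n * k) = (w ^ k) ^ ((j + n - i) mod n + i)"
      by (simp add: algebra_simps flip: power_mult power_add)
    also have "\<dots> = (w ^ k) ^ (((j + n - i) mod n + i) mod n)"
      by (rule power_mod_root_of_unity[OF wk, symmetric])
    also have "\<dots> = w ^ (j * k)"
      by (simp add: eq mult.commute flip: power_mult)
    finally show "c ! ((j + n - i) mod n) * (w ^ (i * k) * w ^ ((j + n - i) mod n * k)) =
        c ! ((j + n - i) mod n) * w ^ (j * k)"
      by simp
  qed (use n in auto)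
  then show ?thesis
    by (simp add: circulant_eigenvalue_def sum_distrib_left n_def w_def mult_ac)
qed

lemma proots_prod_list_linear:
  fixes f :: "'b \<Rightarrow> 'a :: idom"
  shows "proots (\<Prod>x\<leftarrow>xs. [:- f x, 1:]) = image_mset f (mset xs)"
proof (induction xs)
  case (Cons x xs)
  have "(\<Prod>x\<leftarrow>xs. [:- f x, 1:]) \<noteq> 0"
    by (auto simp: prod_list_zero_iff)
  then show ?case
    using Cons by (simp add: proots_mult del: mult_pCons_left)
qed simp

text \<open>The columns of the Fourier matrix \<open>F\<close> are the eigenvectors found above, so
  \<open>F\<close> conjugates the circulant matrix to the diagonal matrix \<open>L\<close>, whose
  characteristic polynomial is a product of linear factors. Orthogonality of the columns makes
  \<open>G\<close> the inverse of \<open>F\<close>.\<close>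

lemma proots_char_poly_circulant_mat:
  fixes c :: "complex list"
  assumes "c \<noteq> []"
  shows "proots (char_poly (circulant_mat c)) =
    image_mset (circulant_eigenvalue c) (mset [0..<length c])"
proof -
  define n where "n = length c"
  define w where "w = cis (2 * pi / n)"
  define F where "F = mat n n (\<lambda>(i, k). w ^ (i * k))"
  define G where "G = mat n n (\<lambda>(k, i). inverse (w ^ (i * k)) / of_nat n)"
  define L where "L = mat n n (\<lambda>(i, k). if i = k then circulant_eigenvalue c k else 0)"
  have n: "n > 0" using assms by (simp add: n_def)
  have carr [simp]: "F \<in> carrier_mat n n" "G \<in> carrier_mat n n" "L \<in> carrier_mat n n"
    "circulant_mat c \<in> carrier_mat n n"
    by (auto simp: F_def G_def L_def n_def)
  have dims [simp]: "dim_row F = n" "dim_col F = n" "dim_row G = n" "dim_col G = n"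
    "dim_row L = n" "dim_col L = n" "dim_row (circulant_mat c) = n" "dim_col (circulant_mat c) = n"
    using carr by blast+
  have GF: "G * F = 1\<^sub>m n"
  proof (rule eq_matI)
    fix k m assume km: "k < dim_row (1\<^sub>m n :: complex mat)" "m < dim_col (1\<^sub>m n :: complex mat)"
    then have "(G * F) $$ (k, m) =
        (\<Sum>j<n. w ^ (j * m) * inverse (w ^ (j * k))) / of_nat n"
      by (simp add: scalar_prod_def F_def G_def sum_divide_distrib mult_ac lessThan_atLeast0)
    also have "\<dots> = 1\<^sub>m n $$ (k, m)"
      using km n cis_power_orthogonality[of m n k] by (simp add: w_def)
    finally show "(G * F) $$ (k, m) = 1\<^sub>m n $$ (k, m)" .
  qed auto
  then have FG: "F * G = 1\<^sub>m n"
    by (intro mat_mult_left_right_inverse[of G n F]) auto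
  have CF: "circulant_mat c * F = F * L"
  proof (rule eq_matI)
    fix i k assume ik: "i < dim_row (F * L)" "k < dim_col (F * L)"
    then have "(circulant_mat c * F) $$ (i, k) =
        (\<Sum>j<n. c ! ((j + n - i) mod n) * w ^ (j * k))"
      by (simp add: scalar_prod_def F_def circulant_mat_def Let_def lessThan_atLeast0
          flip: n_def)
    also have "\<dots> = w ^ (i * k) * circulant_eigenvalue c k"
      using circulant_mat_eigenvector[of i c k] ik by (simp add: n_def w_def)
    also have "\<dots> = (F * L) $$ (i, k)"
      using ik by (simp add: scalar_prod_def F_def L_def if_distrib cong: if_cong)
    finally show "(circulant_mat c * F) $$ (i, k) = (F * L) $$ (i, k)" .
  qed auto
  have "circulant_mat c = circulant_mat c * (F * G)"
    by (simp add: FG right_mult_one_mat[OF carr(4)])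
  also have "\<dots> = F * L * G"
    by (simp add: CF flip: assoc_mult_mat[OF carr(4) carr(1) carr(2)])
  finally have "circulant_mat c = F * L * G" .
  then have "similar_mat_wit (circulant_mat c) L F G"
    unfolding similar_mat_wit_def Let_def dims by (intro conjI FG GF) (use carr in blast)
  then have "char_poly (circulant_mat c) = char_poly L"
    by (intro char_poly_similar) (auto simp: similar_mat_def)
  also have "\<dots> = (\<Prod>a\<leftarrow>diag_mat L. [:- a, 1:])"
    by (rule char_poly_upper_triangular[OF carr(3)]) (auto simp: L_def)
  also have "diag_mat L = map (circulant_eigenvalue c) [0..<n]"
    by (simp add: diag_mat_def L_def)
  finally have "char_poly (circulant_mat c) =
      prod_list (map (\<lambda>k. [:- circulant_eigenvalue c k, 1:]) [0..<n])"
    by (simp add: o_def)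
  also have "proots \<dots> = image_mset (circulant_eigenvalue c) (mset [0..<n])"
    by (rule proots_prod_list_linear)
  finally show ?thesis by (simp add: n_def)
qed

section \<open>Explicit eigenvalues in order 12\<close>

text \<open>Explicit real and imaginary parts reduce the Fourier sums of order 12 to arithmetic with
  rationals and \<open>sqrt 3\<close>. The whole table follows from the values at 30 degrees through
  \<open>w ^ 3 = \<i>\<close> and \<open>w ^ 6 = -1\<close>.\<close>

lemma cis_pi_6_power:
  assumes "m < 12"
  shows "cis (pi / 6) ^ m =
    [1, Complex (sqrt 3 / 2) (1 / 2), Complex (1 / 2) (sqrt 3 / 2), \<i>,
     Complex (- 1 / 2) (sqrt 3 / 2), Complex (- sqrt 3 / 2) (1 / 2), -1,
     Complex (- sqrt 3 / 2) (- 1 / 2), Complex (- 1 / 2) (- sqrt 3 / 2), - \<i>,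
     Complex (1 / 2) (- sqrt 3 / 2), Complex (sqrt 3 / 2) (- 1 / 2)] ! m"
proof -
  define w where "w = cis (pi / 6)"
  have w: "w = Complex (sqrt 3 / 2) (1 / 2)"
    by (simp add: w_def complex_eq_iff cos_30 sin_30)
  have w2: "w ^ 2 = Complex (1 / 2) (sqrt 3 / 2)"
    by (simp add: w complex_eq_iff power2_eq_square)
  have w3: "w ^ 3 = \<i>"
    using w2 by (simp add: w complex_eq_iff power3_eq_cube power2_eq_square)
  have w6: "w ^ 6 = -1"
    using power_mult[of w 3 2] by (simp add: w3)
  have w4: "w ^ 4 = \<i> * w" and w5: "w ^ 5 = \<i> * w ^ 2"
    using power_add[of w 3 1] power_add[of w 3 2] by (simp_all add: w3)
  have w7: "w ^ 7 = - w" "w ^ 8 = - (w ^ 2)" "w ^ 9 = - (w ^ 3)" "w ^ 10 = - (w ^ 4)"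
    "w ^ 11 = - (w ^ 5)"
    using power_add[of w 6 1] power_add[of w 6 2] power_add[of w 6 3] power_add[of w 6 4]
      power_add[of w 6 5] by (simp_all add: w6)
  have "m \<in> {0,1,2,3,4,5,6,7,8,9,10,11}" using assms by (auto simp: less_Suc_eq numeral_eq_Suc)
  then show ?thesis
    unfolding w_def[symmetric]
    by (elim insertE emptyE) (simp_all add: w7 w6 w5 w4 w3 w2, simp_all add: w complex_eq_iff)
qed

text \<open>The coefficients of \<open>sqrt 3\<close> in the eigenvalues of a symmetric circulant matrix of order 12
  are multiples of \<open>c1 - c5\<close>; for \<open>c1 = c5\<close> they vanish.\<close>

definition circulant12_eigenvalues :: "int \<Rightarrow> int \<Rightarrow> int \<Rightarrow> int \<Rightarrow> int \<Rightarrow> int \<Rightarrow> int list" where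
  "circulant12_eigenvalues c0 c1 c2 c3 c4 c6 =
     [c0 + 4 * c1 + 2 * c2 + 2 * c3 + 2 * c4 + c6, c0 - 4 * c1 + 2 * c2 - 2 * c3 + 2 * c4 + c6] @
     replicate 4 (c0 + c2 - c4 - c6) @
     replicate 2 (c0 + 2 * c1 - c2 - 2 * c3 - c4 + c6) @
     replicate 2 (c0 - 2 * c2 + 2 * c4 - c6) @
     replicate 2 (c0 - 2 * c1 - c2 + 2 * c3 - c4 + c6)"

text \<open>Symmetry of the row gives frequencies \<open>k\<close> and \<open>12 - k\<close> the
  same eigenvalue, and equality of the entries at distances 1 and 5 also merges
  \<open>{1, 11}\<close> with \<open>{5, 7}\<close>.\<close>

lemma spectrum_mset_circulant12:
  "spectrum_mset (circulant_mat [c0, c1, c2, c3, c4, c1, c6, c1, c4, c3, c2, c1]) =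
    image_mset of_int (mset (circulant12_eigenvalues c0 c1 c2 c3 c4 c6))"
proof -
  define c :: "complex list"
    where "c = map of_int [c0, c1, c2, c3, c4, c1, c6, c1, c4, c3, c2, c1]"
  have spec: "spectrum_mset (circulant_mat [c0, c1, c2, c3, c4, c1, c6, c1, c4, c3, c2, c1]) =
      image_mset (circulant_eigenvalue c) (mset [0..<12])"
  proof -
    have "c \<noteq> []" "length c = 12" by (simp_all add: c_def)
    then show ?thesis
      using proots_char_poly_circulant_mat[of c]
      by (simp only: not_False_eq_True simp_thms spectrum_mset_def map_mat_circulant_mat flip: c_def)
  qed
  \<comment> \<open>Exponents are reduced modulo 12 to bring them into the range of the table
    \<open>cis_pi_6_power\<close>.\<close>
  have W: "cis (pi / 6) ^ m = cis (pi / 6) ^ (m mod 12)" for m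
    using power_mod_root_of_unity[of "cis (pi / 6)" 12 m] cis_root_of_unity[of 12] by simp
  have eig: "circulant_eigenvalue c k = (\<Sum>j\<leftarrow>[0,1,2,3,4,5,6,7,8,9,10,11].
      c ! j * cis (pi / 6) ^ (j * k mod 12))" for k
  proof -
    have "circulant_eigenvalue c k = (\<Sum>j<12. c ! j * cis (pi / 6) ^ (j * k))"
    proof -
      have "length c = 12" "2 * pi / real 12 = pi / 6" by (simp_all add: c_def)
      then show ?thesis by (simp only: circulant_eigenvalue_def)
    qed
    also have "\<dots> = (\<Sum>j<12. c ! j * cis (pi / 6) ^ (j * k mod 12))"
      by (intro sum.cong refl arg_cong2[where f = "(*)"] W)
    also have "\<dots> = (\<Sum>j\<leftarrow>[0..<12]. c ! j * cis (pi / 6) ^ (j * k mod 12))"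
      by (simp add: sum_list_distinct_conv_sum_set lessThan_atLeast0)
    also have "[0..<12] = [0,1,2,3,4,5,6,7,8,9,10,11]"
      by (simp add: upt_rec)
    finally show ?thesis .
  qed
  note simps = cis_pi_6_power c_def complex_eq_iff algebra_simps
  have "circulant_eigenvalue c 0 = of_int (c0 + 4 * c1 + 2 * c2 + 2 * c3 + 2 * c4 + c6)"
    by (subst eig) (simp add: simps)
  moreover have "circulant_eigenvalue c 6 = of_int (c0 - 4 * c1 + 2 * c2 - 2 * c3 + 2 * c4 + c6)"
    by (subst eig) (simp add: simps)
  moreover have "circulant_eigenvalue c k = of_int (c0 + c2 - c4 - c6)" if "k \<in> {1, 5, 7, 11}" for k
    using that by (subst eig, elim insertE emptyE) (simp_all add: simps)
  moreover have "circulant_eigenvalue c k = of_int (c0 + 2 * c1 - c2 - 2 * c3 - c4 + c6)"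
    if "k \<in> {2, 10}" for k
    using that by (subst eig, elim insertE emptyE) (simp_all add: simps)
  moreover have "circulant_eigenvalue c k = of_int (c0 - 2 * c2 + 2 * c4 - c6)" if "k \<in> {3, 9}" for k
    using that by (subst eig, elim insertE emptyE) (simp_all add: simps)
  moreover have "circulant_eigenvalue c k = of_int (c0 - 2 * c1 - c2 + 2 * c3 - c4 + c6)"
    if "k \<in> {4, 8}" for k
    using that by (subst eig, elim insertE emptyE) (simp_all add: simps)
  \<comment> \<open>The frequencies are rearranged to match the order of the groups in
    \<open>circulant12_eigenvalues\<close>.\<close>
  moreover have "mset [0..<12] = mset [0, 6, 1, 5, 7, 11, 2, 10, 3, 9, 4, 8::nat]"
    by (simp add: upt_rec numeral_eq_Suc)
  ultimately show ?thesis
    unfolding spec circulant12_eigenvalues_def by (simp add: numeral_eq_Suc)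
qed

section \<open>Designs with circulant concurrence matrix\<close>

lemma sum_mset_indicator: "(\<Sum>x\<in>#A. if P x then 1 else 0) = size (filter_mset P A)"
  by (induction A) auto

lemma sum_list_nth_conv: "(\<Sum>j<length xs. f (xs ! j)) = (\<Sum>x\<in>#mset xs. f x)"
  by (simp add: sum_list_sum_nth lessThan_atLeast0 sum_mset_sum_list flip: mset_map)

lemma concurrence_matrix_dim [simp]:
  "dim_row (concurrence_matrix ps bs) = length ps" "dim_col (concurrence_matrix ps bs) = length ps"
  by (simp_all add: concurrence_matrix_def incidence_matrix_def)

lemma concurrence_matrix_index:
  assumes "i < length ps" "j < length ps"
  shows "concurrence_matrix ps bs $$ (i, j) =
    int (size {#B \<in># mset bs. ps ! i \<in> B \<and> ps ! j \<in> B#})"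
proof -
  have "concurrence_matrix ps bs $$ (i, j) =
      (\<Sum>m<length bs. if ps ! i \<in> bs ! m \<and> ps ! j \<in> bs ! m then 1 else 0)"
    using assms unfolding concurrence_matrix_def incidence_matrix_def
    by (auto simp: scalar_prod_def lessThan_atLeast0 intro!: sum.cong)
  also have "\<dots> = int (\<Sum>m<length bs. if ps ! i \<in> bs ! m \<and> ps ! j \<in> bs ! m then 1 else 0)"
    by (auto simp: of_nat_sum intro!: sum.cong)
  also have "(\<Sum>m<length bs. if ps ! i \<in> bs ! m \<and> ps ! j \<in> bs ! m then 1 else 0) =
      size {#B \<in># mset bs. ps ! i \<in> B \<and> ps ! j \<in> B#}"
    using sum_list_nth_conv[of "\<lambda>B. if ps ! i \<in> B \<and> ps ! j \<in> B then 1 else (0::nat)" bs]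
    by (simp add: sum_mset_indicator)
  finally show ?thesis .
qed

text \<open>The entry of \<open>N N^T N\<close> at a point \<open>x\<close> and a block
  \<open>B\<close> is the sum over \<open>y\<close> in \<open>B\<close> of the concurrences of
  \<open>x\<close> and \<open>y\<close>. The right-hand side has there \<beta> on flags and \<alpha>
  elsewhere. Neither depends on the ordering, so one check covers all orderings.\<close>

lemma partial_geometric_designI:
  assumes tac: "tactical_configuration V \<B> v b k r"
    and flags: "\<And>x B. x \<in> V \<Longrightarrow> B \<in># \<B> \<Longrightarrow>
      (\<Sum>y\<in>B. size {#B' \<in># \<B>. x \<in> B' \<and> y \<in> B'#}) = (if x \<in> B then \<beta> else \<alpha>)"
  shows "partial_geometric_design V \<B> v b k r \<alpha> \<beta>"
  unfolding partial_geometric_design_def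
proof (intro conjI allI impI tac)
  fix ps bs assume ord: "is_ordering ps bs V \<B>"
  define N where "N = incidence_matrix ps bs"
  have ps: "distinct ps" "set ps = V" "mset bs = \<B>"
    using ord by (auto simp: is_ordering_def)
  have len: "length ps = v" "length bs = b"
    using tac ps distinct_card[of ps] by (auto simp: tactical_configuration_def)
  have N: "N \<in> carrier_mat v b"
    by (simp add: N_def incidence_matrix_def len)
  have NN: "N * transpose_mat N = concurrence_matrix ps bs"
    by (simp add: N_def concurrence_matrix_def)
  have "N * transpose_mat N * N = int \<beta> \<cdot>\<^sub>m N + int \<alpha> \<cdot>\<^sub>m (all_ones_mat v b - N)"
  proof (rule eq_matI)
    fix i j
    assume "i < dim_row (int \<beta> \<cdot>\<^sub>m N + int \<alpha> \<cdot>\<^sub>m (all_ones_mat v b - N))"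
      "j < dim_col (int \<beta> \<cdot>\<^sub>m N + int \<alpha> \<cdot>\<^sub>m (all_ones_mat v b - N))"
    then have ij: "i < v" "j < b" using N by auto
    have x: "ps ! i \<in> V" and B: "bs ! j \<in># \<B>"
      using ij len ps by (auto simp flip: ps(2,3))
    have sub: "bs ! j \<subseteq> V"
      using B tac by (auto simp: tactical_configuration_def)
    have "(N * transpose_mat N * N) $$ (i, j) =
        (\<Sum>m<v. int (size {#B' \<in># \<B>. ps ! i \<in> B' \<and> ps ! m \<in> B'#}) *
          (if ps ! m \<in> bs ! j then 1 else 0))"
      unfolding NN using ij len
      by (simp add: scalar_prod_def concurrence_matrix_index ps N_def incidence_matrix_def
          lessThan_atLeast0)
    also have "\<dots> = (\<Sum>y\<in>V. int (size {#B' \<in># \<B>. ps ! i \<in> B' \<and> y \<in> B'#}) *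
          (if y \<in> bs ! j then 1 else 0))"
      by (rule sum.reindex_bij_betw) (use bij_betw_nth[OF ps(1) _ ps(2)[symmetric]] len in simp)
    also have "\<dots> = (\<Sum>y\<in>bs ! j. int (size {#B' \<in># \<B>. ps ! i \<in> B' \<and> y \<in> B'#}))"
      by (rule sum.mono_neutral_cong_right) (use sub tac in \<open>auto simp: tactical_configuration_def\<close>)
    also have "\<dots> = (if ps ! i \<in> bs ! j then int \<beta> else int \<alpha>)"
      by (simp add: flags[OF x B] flip: of_nat_sum)
    finally show "(N * transpose_mat N * N) $$ (i, j) =
        (int \<beta> \<cdot>\<^sub>m N + int \<alpha> \<cdot>\<^sub>m (all_ones_mat v b - N)) $$ (i, j)"
      using ij len by (simp add: N_def incidence_matrix_def all_ones_mat_def)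
  qed (use N in auto)
  then show "let N = incidence_matrix ps bs in
      N * transpose_mat N * N = int \<beta> \<cdot>\<^sub>m N + int \<alpha> \<cdot>\<^sub>m (all_ones_mat v b - N)"
    by (simp add: N_def)
qed

text \<open>The quantifiers range over lists so that concrete instances can be evaluated.\<close>

definition circulant_design ::
  "nat list \<Rightarrow> nat \<Rightarrow> nat \<Rightarrow> nat \<Rightarrow> nat \<Rightarrow> nat \<Rightarrow> nat set list \<Rightarrow> bool" where
  "circulant_design c b k \<alpha> \<beta> l D \<longleftrightarrow>
     (let n = length c in
      length D = b * l \<and>
      (\<forall>B\<in>set D. B \<subseteq> set [0..<n] \<and> card B = k \<and>
        (\<forall>x\<in>set [0..<n].
          (\<Sum>y\<in>B. c ! ((y + n - x) mod n)) = (if x \<in> B then \<beta> else \<alpha>))) \<and>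
      (\<forall>x\<in>set [0..<n]. \<forall>y\<in>set [0..<n].
        length (filter (\<lambda>B. x \<in> B \<and> y \<in> B) D) = c ! ((y + n - x) mod n) * l))"

text \<open>The condition on single blocks mentions \<open>c\<close> but not \<open>l\<close>, so it
  passes to the concatenation; the number of blocks and the pair counts add up.\<close>

lemma circulant_design_append:
  assumes "circulant_design c b k \<alpha> \<beta> l D" "circulant_design c b k \<alpha> \<beta> l' D'"
  shows "circulant_design c b k \<alpha> \<beta> (l + l') (D @ D')"
  using assms unfolding circulant_design_def Let_def
  by (simp add: ball_Un distrib_left)

lemma circulant_design_multiples:
  assumes "circulant_design c b k \<alpha> \<beta> 1 D" "l \<ge> 1"
  shows "\<exists>D. circulant_design c b k \<alpha> \<beta> l D"
  using assms(2)
proof (induction l rule: dec_induct)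
  case base
  show ?case using assms(1) by blast
next
  case (step l)
  then show ?case using circulant_design_append[OF _ assms(1)] by fastforce
qed

text \<open>Every integer from 2 on is a sum of twos and threes.\<close>

lemma circulant_design_multiples_2_3:
  assumes "circulant_design c b k \<alpha> \<beta> 2 D" "circulant_design c b k \<alpha> \<beta> 3 D'" "l \<ge> 2"
  shows "\<exists>D. circulant_design c b k \<alpha> \<beta> l D"
  using assms(3)
proof (induction l rule: less_induct)
  case (less l)
  show ?case
  proof (cases "l \<le> 3")
    case True
    then have "l = 2 \<or> l = 3" using less.prems by auto
    then show ?thesis using assms by blast
  next
    case False
    then obtain m where m: "l = m + 2" "m < l" "m \<ge> 2"
      by (intro that[of "l - 2"]) auto
    then show ?thesis
      using less.IH[of m] circulant_design_append[OF _ assms(1)] by blast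
  qed
qed

lemma circulant_design_concurrence_matrix:
  assumes "circulant_design c b k \<alpha> \<beta> l D"
  shows "concurrence_matrix [0..<length c] D = circulant_mat (map (\<lambda>x. int (x * l)) c)"
proof (rule eq_matI)
  fix i j
  assume "i < dim_row (circulant_mat (map (\<lambda>x. int (x * l)) c))"
    "j < dim_col (circulant_mat (map (\<lambda>x. int (x * l)) c))"
  then have ij: "i < length c" "j < length c"
    by (auto simp: circulant_mat_def Let_def)
  then have "(j + length c - i) mod length c < length c"
    by (intro mod_less_divisor) auto
  then show "concurrence_matrix [0..<length c] D $$ (i, j) =
      circulant_mat (map (\<lambda>x. int (x * l)) c) $$ (i, j)"
    using assms ij
    by (simp add: concurrence_matrix_index circulant_mat_def circulant_design_def Let_def
        flip: mset_filter)
qed (auto simp: circulant_mat_def Let_def)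

text \<open>The replication number is the pair count at \<open>x = y\<close>, hence
  \<open>c ! 0 * l\<close>. Actual concurrences are \<open>l\<close> times the entries of
  \<open>c\<close>, which multiplies both flag sums by \<open>l\<close>.\<close>

lemma circulant_design_partial_geometric:
  assumes D: "circulant_design c b k \<alpha> \<beta> l D"
  shows "partial_geometric_design {..<length c} (mset D) (length c) (b * l) k (c ! 0 * l)
    (\<alpha> * l) (\<beta> * l)"
proof -
  define n where "n = length c"
  have size: "size {#B \<in># mset D. x \<in> B \<and> y \<in> B#} = c ! ((y + n - x) mod n) * l"
    if "x < n" "y < n" for x y
    using that D by (simp add: circulant_design_def Let_def n_def flip: mset_filter)
  have blocks: "B \<subseteq> {..<n}" "card B = k"
    "x < n \<Longrightarrow> (\<Sum>y\<in>B. c ! ((y + n - x) mod n)) = (if x \<in> B then \<beta> else \<alpha>)"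
    if "B \<in># mset D" for B x
    using that D by (auto simp: circulant_design_def Let_def n_def lessThan_atLeast0)
  have tac: "tactical_configuration {..<n} (mset D) n (b * l) k (c ! 0 * l)"
    unfolding tactical_configuration_def
    using D blocks size[of x x for x] by (simp add: circulant_design_def Let_def)
  show ?thesis
    unfolding n_def[symmetric]
  proof (rule partial_geometric_designI[OF tac])
    fix x B assume x: "x \<in> {..<n}" and B: "B \<in># mset D"
    have "(\<Sum>y\<in>B. size {#B' \<in># mset D. x \<in> B' \<and> y \<in> B'#}) =
        (\<Sum>y\<in>B. c ! ((y + n - x) mod n) * l)"
      using x blocks(1)[OF B] by (intro sum.cong size) auto
    also have "\<dots> = (if x \<in> B then \<beta> * l else \<alpha> * l)"
      using blocks(3)[OF B, of x] x by (simp flip: sum_distrib_right)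
    finally show "(\<Sum>y\<in>B. size {#B' \<in># mset D. x \<in> B' \<and> y \<in> B'#}) =
        (if x \<in> B then \<beta> * l else \<alpha> * l)" .
  qed
qed

text \<open>The spectral hypothesis concerns only the unscaled row, so it is a finite computation
  valid for all \<open>l\<close>. Its eigenvalue \<open>k * c0\<close> is \<open>kr\<close> divided
  by \<open>l\<close>.\<close>

lemma realized12I:
  assumes design: "\<exists>D. circulant_design [c0, c1, c2, c3, c4, c1, c6, c1, c4, c3, c2, c1] b k \<alpha> \<beta> l D"
    and spec: "mset (circulant12_eigenvalues (int c0) (int c1) (int c2) (int c3) (int c4) (int c6)) =
      mset (int (k * c0) # replicate \<sigma> (int n) @ replicate (11 - \<sigma>) 0)"
  shows "realized12 (sym_circulant12 (c0 * l) (c1 * l) (c2 * l) (c3 * l) (c4 * l) (c1 * l) (c6 * l))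
    k (n * l) \<sigma> (b * l) (c0 * l) (\<alpha> * l) (\<beta> * l)"
proof -
  obtain D where D: "circulant_design [c0, c1, c2, c3, c4, c1, c6, c1, c4, c3, c2, c1] b k \<alpha> \<beta> l D"
    using design by blast
  let ?M = "sym_circulant12 (c0 * l) (c1 * l) (c2 * l) (c3 * l) (c4 * l) (c1 * l) (c6 * l)"
  have len: "length [c0, c1, c2, c3, c4, c1, c6, c1, c4, c3, c2, c1] = 12" by simp
  have M: "concurrence_matrix [0..<12] D = ?M"
    using circulant_design_concurrence_matrix[OF D, unfolded len]
    by (simp only: sym_circulant12_def list.map)
  \<comment> \<open>Eigenvalues are linear in the entries of the row, so the factor \<open>l\<close>
    can be taken out of each.\<close>
  have "spectrum_mset ?M =
      image_mset (\<lambda>x. of_int (x * int l)) (mset (circulant12_eigenvalues (int c0) (int c1) (int c2) (int c3) (int c4) (int c6)))"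
    unfolding sym_circulant12_def list.map spectrum_mset_circulant12
    by (simp add: circulant12_eigenvalues_def numeral_eq_Suc algebra_simps)
  also have "\<dots> = {#of_nat (k * (c0 * l))#} + replicate_mset \<sigma> (of_nat (n * l)) +
      replicate_mset (11 - \<sigma>) 0"
    unfolding spec by (simp add: mult_ac)
  finally have "spectrum_mset ?M = \<dots>" .
  moreover have "partial_geometric_design {..<12} (mset D) 12 (b * l) k (c0 * l) (\<alpha> * l) (\<beta> * l)"
    using circulant_design_partial_geometric[OF D, unfolded len] by (simp only: nth_Cons_0)
  moreover have "is_ordering [0..<12] D {..<12} (mset D)"
    by (auto simp: is_ordering_def)
  ultimately show ?thesis
    unfolding realized12_def M[symmetric] by blast
qed

text \<open>Symmetry comes from the form \<open>N N^T\<close> of a concurrence matrix, and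
  integrality of the eigenvalues from the prescribed spectrum.\<close>

lemma realized12_imp_sym_integral_circulant:
  assumes "realized12 (sym_circulant12 c0 c1 c2 c3 c4 c5 c6) k n \<sigma> b r \<alpha> \<beta>"
  shows "sym_integral_circulant 12 (sym_circulant12 c0 c1 c2 c3 c4 c5 c6)"
    "is_pgd_concurrence_matrix (sym_circulant12 c0 c1 c2 c3 c4 c5 c6)"
proof -
  let ?M = "sym_circulant12 c0 c1 c2 c3 c4 c5 c6"
  obtain V :: "nat set" and \<B> ps bs where pgd: "partial_geometric_design V \<B> 12 b k r \<alpha> \<beta>"
    "is_ordering ps bs V \<B>" and M: "concurrence_matrix ps bs = ?M"
    and spec: "spectrum_mset ?M =
      {#of_nat (k * r)#} + replicate_mset \<sigma> (of_nat n) + replicate_mset (11 - \<sigma>) 0"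
    using assms unfolding realized12_def by metis
  show "is_pgd_concurrence_matrix ?M"
    unfolding is_pgd_concurrence_matrix_def using pgd M by blast
  have "transpose_mat ?M = ?M"
    unfolding M[symmetric] concurrence_matrix_def
    by (subst transpose_mult[of _ "length ps" "length bs"]) (auto simp: incidence_matrix_def)
  moreover have "?M \<in> carrier_mat 12 12"
    unfolding sym_circulant12_def by (rule carrier_matI) (simp_all add: circulant_mat_def Let_def)
  moreover have "\<exists>c. length c = 12 \<and> ?M = circulant_mat c"
    unfolding sym_circulant12_def by (rule exI, rule conjI[OF _ refl]) simp
  moreover have "set_mset (spectrum_mset ?M) \<subseteq> \<int>"
    unfolding spec by (auto split: if_splits)
  ultimately show "sym_integral_circulant 12 ?M"
    unfolding sym_integral_circulant_def by blast
qed

section \<open>Base designs\<close>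

text \<open>A transversal design whose groups are the residue classes modulo 3, that is, a Latin
  square of order 4. The block list is not invariant under rotation; only its concurrences
  are.\<close>

lemma design_row_1:
  "circulant_design [4, 1, 1, 0, 1, 1, 0, 1, 1, 0, 1, 1] 16 3 2 6 1
    [{0, 1, 11}, {0, 2, 7}, {0, 4, 5}, {0, 8, 10}, {1, 2, 6},
     {1, 3, 8}, {1, 5, 9}, {2, 3, 4}, {2, 9, 10}, {3, 5, 7},
     {3, 10, 11}, {4, 6, 8}, {4, 9, 11}, {5, 6, 10}, {6, 7, 11},
     {7, 8, 9}]"
  by code_simp

text \<open>The antipodal points \<open>i\<close> and \<open>i + 6\<close> always occur together. On
  the six antipodal pairs the blocks are the edges of the complete bipartite graph between even and
  odd residues modulo 6.\<close>

lemma design_row_2: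
  "circulant_design [3, 1, 0, 1, 0, 1, 3, 1, 0, 1, 0, 1] 9 4 2 8 1
    [{0, 1, 6, 7}, {0, 3, 6, 9}, {0, 5, 6, 11}, {1, 2, 7, 8}, {1, 4, 7, 10},
     {2, 3, 8, 9}, {2, 5, 8, 11}, {3, 4, 9, 10}, {4, 5, 10, 11}]"
  by code_simp

text \<open>On the six antipodal pairs the blocks are the edges of the complete graph.\<close>

lemma design_row_3:
  "circulant_design [5, 1, 1, 1, 1, 1, 5, 1, 1, 1, 1, 1] 15 4 4 12 1
    [{0, 1, 6, 7}, {0, 2, 6, 8}, {0, 3, 6, 9}, {0, 4, 6, 10}, {0, 5, 6, 11},
     {1, 2, 7, 8}, {1, 3, 7, 9}, {1, 4, 7, 10}, {1, 5, 7, 11}, {2, 3, 8, 9},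
     {2, 4, 8, 10}, {2, 5, 8, 11}, {3, 4, 9, 10}, {3, 5, 9, 11}, {4, 5, 10, 11}]"
  by code_simp

text \<open>Each residue class modulo 3 is a 4-cycle with steps of 3. Every block joins one edge
  from each of two of these cycles, and every edge is used twice.\<close>

lemma design_row_4:
  "circulant_design [4, 1, 1, 2, 1, 1, 0, 1, 1, 2, 1, 1] 12 4 4 8 1
    [{0, 1, 3, 10}, {0, 2, 9, 11}, {0, 3, 4, 7}, {0, 5, 8, 9}, {1, 2, 4, 5},
     {1, 4, 8, 11}, {1, 6, 9, 10}, {2, 3, 5, 6}, {2, 7, 10, 11}, {3, 6, 8, 11},
     {4, 6, 7, 9}, {5, 7, 8, 10}]"
  by code_simp

text \<open>A transversal design with the residue classes modulo 4 as groups: the dual of the affine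
  plane of order 3.\<close>

lemma design_row_5:
  "circulant_design [3, 1, 1, 1, 0, 1, 1, 1, 0, 1, 1, 1] 9 4 3 6 1
    [{0, 1, 2, 7}, {0, 3, 5, 6}, {0, 9, 10, 11}, {1, 3, 4, 10}, {1, 6, 8, 11},
     {2, 3, 8, 9}, {2, 4, 5, 11}, {4, 6, 7, 9}, {5, 7, 8, 10}]"
  by code_simp

text \<open>On the six antipodal pairs this is the transversal design with three groups of size 2,
  blown up by doubling each point.\<close>

lemma design_row_6:
  "circulant_design [2, 1, 1, 0, 1, 1, 2, 1, 1, 0, 1, 1] 4 6 4 8 1
    [{0, 1, 5, 6, 7, 11}, {0, 2, 4, 6, 8, 10}, {1, 2, 3, 7, 8, 9}, {3, 4, 5, 9, 10, 11}]"
  by code_simp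

text \<open>The edges of the complete graph on the four residue classes modulo 4, each class being
  treated as one point.\<close>

lemma design_row_7:
  "circulant_design [3, 1, 1, 1, 3, 1, 1, 1, 3, 1, 1, 1] 6 6 6 12 1
    [{0, 1, 4, 5, 8, 9}, {0, 2, 4, 6, 8, 10}, {0, 3, 4, 7, 8, 11}, {1, 2, 5, 6, 9, 10},
     {1, 3, 5, 7, 9, 11}, {2, 3, 6, 7, 10, 11}]"
  by code_simp

text \<open>A 2-(6,3,2) design on the six antipodal pairs.\<close>

lemma design_row_8:
  "circulant_design [5, 2, 2, 2, 2, 2, 5, 2, 2, 2, 2, 2] 10 6 12 18 1
    [{0, 1, 2, 6, 7, 8}, {0, 1, 5, 6, 7, 11}, {0, 2, 4, 6, 8, 10}, {0, 3, 4, 6, 9, 10},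
     {0, 3, 5, 6, 9, 11}, {1, 2, 3, 7, 8, 9}, {1, 3, 4, 7, 9, 10}, {1, 4, 5, 7, 10, 11},
     {2, 3, 5, 8, 9, 11}, {2, 4, 5, 8, 10, 11}]"
  by code_simp

text \<open>Each block takes one point from every antipodal pair, so a pair yields a sign vector
  indexed by the \<open>4 * l\<close> blocks. Such balanced vectors lie in dimension
  \<open>4 * l - 1\<close>, which leaves room for six orthogonal ones exactly when \<open>l\<close>
  is at least 2.\<close>

lemma design_row_9_2:
  "circulant_design [2, 1, 1, 1, 1, 1, 0, 1, 1, 1, 1, 1] 4 6 5 7 2
    [{0, 1, 3, 8, 10, 11}, {0, 1, 4, 5, 8, 9}, {0, 2, 3, 4, 5, 7}, {0, 2, 7, 9, 10, 11},
     {1, 2, 3, 4, 6, 11}, {1, 2, 5, 6, 9, 10}, {3, 5, 6, 7, 8, 10}, {4, 6, 7, 8, 9, 11}]"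
  by code_simp

lemma design_row_9_3:
  "circulant_design [2, 1, 1, 1, 1, 1, 0, 1, 1, 1, 1, 1] 4 6 5 7 3
    [{0, 1, 2, 3, 4, 5}, {0, 1, 3, 8, 10, 11}, {0, 1, 4, 5, 8, 9}, {0, 2, 3, 5, 7, 10},
     {0, 2, 7, 9, 10, 11}, {0, 4, 7, 8, 9, 11}, {1, 2, 3, 4, 6, 11}, {1, 2, 6, 9, 10, 11},
     {1, 5, 6, 8, 9, 10}, {2, 4, 5, 6, 7, 9}, {3, 4, 6, 7, 8, 11}, {3, 5, 6, 7, 8, 10}]"
  by code_simp

text \<open>The sets of even and of odd points, together with twelve blocks having the concurrences
  of row 9 for \<open>l = 3\<close>.\<close>

lemma design_row_10:
  "circulant_design [7, 3, 4, 3, 4, 3, 1, 3, 4, 3, 4, 3] 14 6 18 24 1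
    [{0, 1, 2, 3, 5, 10}, {0, 1, 2, 9, 10, 11}, {0, 1, 4, 5, 8, 9}, {0, 2, 4, 5, 7, 9},
     {0, 2, 4, 6, 8, 10}, {0, 3, 4, 7, 8, 11}, {0, 3, 7, 8, 10, 11}, {1, 2, 3, 4, 6, 11},
     {1, 3, 4, 5, 6, 8}, {1, 3, 5, 7, 9, 11}, {1, 6, 8, 9, 10, 11}, {2, 3, 5, 6, 7, 10},
     {2, 4, 6, 7, 9, 11}, {5, 6, 7, 8, 9, 10}]"
  by code_simp

text \<open>A group divisible design: every block takes two points from each residue class modulo
  3.\<close>

lemma design_row_11:
  "circulant_design [6, 3, 3, 2, 3, 3, 2, 3, 3, 2, 3, 3] 12 6 16 20 1
    [{0, 1, 2, 9, 10, 11}, {0, 1, 3, 5, 7, 11}, {0, 1, 5, 6, 8, 10}, {0, 2, 3, 4, 8, 10},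
     {0, 2, 4, 6, 7, 11}, {0, 4, 5, 7, 8, 9}, {1, 2, 3, 4, 5, 9}, {1, 2, 3, 6, 7, 8},
     {1, 4, 6, 8, 9, 11}, {2, 5, 6, 7, 9, 10}, {3, 4, 5, 6, 10, 11}, {3, 7, 8, 9, 10, 11}]"
  by code_simp

section \<open>Families of multiples of a circulant matrix\<close>

definition circulant_family :: "nat \<times> nat list \<Rightarrow> int mat set" where
  "circulant_family = (\<lambda>(m, c). {circulant_mat (map (\<lambda>x. int (x * l)) c) | l. l \<ge> m})"

lemma circulant_mat_inject:
  assumes "circulant_mat c = circulant_mat c'" "length c = length c'"
  shows "c = c'"
proof (rule nth_equalityI)
  fix j assume j: "j < length c"
  then have "length c > 0" by linarith
  with j have "circulant_mat c $$ (0, j) = c ! j" "circulant_mat c' $$ (0, j) = c' ! j"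
    using assms(2) by (simp_all add: circulant_mat_index)
  then show "c ! j = c' ! j" using assms(1) by simp
qed (fact assms(2))

text \<open>The nonzero leading entry recovers the multiplier from the matrix, so distinct
  multipliers give distinct matrices.\<close>

lemma infinite_circulant_family:
  assumes "c \<noteq> []" "c ! 0 > 0"
  shows "infinite (circulant_family (m, c))"
proof -
  let ?f = "\<lambda>l. circulant_mat (map (\<lambda>x. int (x * l)) c)"
  have "inj ?f"
  proof (rule injI)
    fix l l' assume "?f l = ?f l'"
    then have "map (\<lambda>x. int (x * l)) c = map (\<lambda>x. int (x * l')) c"
      by (rule circulant_mat_inject) simp
    then have "int (c ! 0 * l) = int (c ! 0 * l')"
      using assms(1) nth_map[of 0 c] by (metis length_greater_0_conv)
    then show "l = l'" using assms(2) by simp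
  qed
  moreover have "infinite {m..}" by (rule infinite_Ici)
  ultimately have "infinite (?f ` {m..})"
    by (metis finite_imageD inj_on_subset subset_UNIV)
  moreover have "circulant_family (m, c) = ?f ` {m..}"
    by (auto simp: circulant_family_def)
  ultimately show ?thesis by simp
qed

text \<open>A common member would make the two base rows proportional. Cross-multiplication by the
  leading entries expresses this without the multipliers, as a condition that can be
  evaluated.\<close>

lemma circulant_families_disjoint:
  assumes "m \<ge> 1" "m' \<ge> 1" "length c = length c'"
    and nonprop: "map ((*) (c' ! 0)) c \<noteq> map ((*) (c ! 0)) c'"
  shows "circulant_family (m, c) \<inter> circulant_family (m', c') = {}"
proof (rule ccontr)
  assume "circulant_family (m, c) \<inter> circulant_family (m', c') \<noteq> {}"
  then obtain l l' where l: "l \<ge> 1" "l' \<ge> 1"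
    and eq: "circulant_mat (map (\<lambda>x. int (x * l)) c) = circulant_mat (map (\<lambda>x. int (x * l')) c')"
    using assms(1,2) by (fastforce simp: circulant_family_def)
  have "map (\<lambda>x. int (x * l)) c = map (\<lambda>x. int (x * l')) c'"
    using eq by (rule circulant_mat_inject) (simp add: assms(3))
  then have "int (c ! j * l) = int (c' ! j * l')" if "j < length c" for j
    using that assms(3) nth_map[of j c "\<lambda>x. int (x * l)"] nth_map[of j c' "\<lambda>x. int (x * l')"] by simp
  then have nth: "c ! j * l = c' ! j * l'" if "j < length c" for j
    using that of_nat_eq_iff by blast
  have "map ((*) (c' ! 0)) c = map ((*) (c ! 0)) c'"
  proof (rule nth_equalityI)
    fix j assume "j < length (map ((*) (c' ! 0)) c)"
    then have j: "j < length c" by simp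
    then have "0 < length c" by linarith
    \<comment> \<open>Both sides carry the positive factor \<open>l * l'\<close>, which is cancelled
      at the end.\<close>
    have "(c' ! 0 * c ! j) * (l * l') = (c ! j * l) * (c' ! 0 * l')"
      by (simp add: mult_ac)
    also have "\<dots> = (c' ! j * l') * (c ! 0 * l)"
      by (simp only: nth[OF j] nth[OF \<open>0 < length c\<close>])
    also have "\<dots> = (c ! 0 * c' ! j) * (l * l')"
      by (simp add: mult_ac)
    finally show "map ((*) (c' ! 0)) c ! j = map ((*) (c ! 0)) c' ! j"
      using l j assms(3) by simp
  qed (simp add: assms(3))
  with nonprop show False by contradiction
qed

lemma circulant_family_sym:
  "circulant_family (m, [c0, c1, c2, c3, c4, c5, c6, c5, c4, c3, c2, c1]) =
    {sym_circulant12 (c0 * l) (c1 * l) (c2 * l) (c3 * l) (c4 * l) (c5 * l) (c6 * l) | l. l \<ge> m}"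
  by (simp add: circulant_family_def sym_circulant12_def)

text \<open>Kept as a list so that all pairs of rows can be compared by evaluation. The first
  component is the least admissible multiplier.\<close>

definition family_table :: "(nat \<times> nat list) list" where
  "family_table =
    [(1, [4, 1, 1, 0, 1, 1, 0, 1, 1, 0, 1, 1]),
     (1, [3, 1, 0, 1, 0, 1, 3, 1, 0, 1, 0, 1]),
     (1, [5, 1, 1, 1, 1, 1, 5, 1, 1, 1, 1, 1]),
     (1, [4, 1, 1, 2, 1, 1, 0, 1, 1, 2, 1, 1]),
     (1, [3, 1, 1, 1, 0, 1, 1, 1, 0, 1, 1, 1]),
     (1, [2, 1, 1, 0, 1, 1, 2, 1, 1, 0, 1, 1]),
     (1, [3, 1, 1, 1, 3, 1, 1, 1, 3, 1, 1, 1]),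
     (1, [5, 2, 2, 2, 2, 2, 5, 2, 2, 2, 2, 2]),
     (2, [2, 1, 1, 1, 1, 1, 0, 1, 1, 1, 1, 1]),
     (1, [7, 3, 4, 3, 4, 3, 1, 3, 4, 3, 4, 3]),
     (1, [6, 3, 3, 2, 3, 3, 2, 3, 3, 2, 3, 3])]"

lemma family_table_props:
  "\<forall>p\<in>set family_table. fst p \<ge> 1 \<and> length (snd p) = 12 \<and> snd p ! 0 > 0"
  "\<forall>p\<in>set family_table. \<forall>q\<in>set family_table. p \<noteq> q \<longrightarrow>
    map ((*) (snd q ! 0)) (snd p) \<noteq> map ((*) (snd p ! 0)) (snd q)"
  "distinct family_table" "length family_table = 11"
  by code_simp+

lemma family_table_disjoint:
  "card (circulant_family ` set family_table) = 11" (is ?card)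
  "disjoint (circulant_family ` set family_table)" (is ?disj)
  "\<forall>F \<in> circulant_family ` set family_table. infinite F" (is ?inf)
proof -
  show inf: ?inf
  proof (rule ballI, erule imageE)
    fix F p assume F: "F = circulant_family p" and p: "p \<in> set family_table"
    have "length (snd p) = 12" "snd p ! 0 > 0" using p family_table_props(1) by auto
    then show "infinite F"
      unfolding F using infinite_circulant_family[of "snd p" "fst p"] by force
  qed
  have "disjoint_family_on circulant_family (set family_table)"
    unfolding disjoint_family_on_def
  proof (intro ballI impI)
    fix p q assume pq: "p \<in> set family_table" "q \<in> set family_table" "p \<noteq> q"
    show "circulant_family p \<inter> circulant_family q = {}"
      using circulant_families_disjoint[of "fst p" "fst q" "snd p" "snd q"]
        pq family_table_props(1,2) by simp
  qed
  \<comment> \<open>Disjoint nonempty sets are distinct. This gives injectivity of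
    \<open>circulant_family\<close> on the table and thereby the count of 11.\<close>
  moreover have "circulant_family p \<noteq> {}" if "p \<in> set family_table" for p
    using inf that by fastforce
  ultimately have "?disj \<and> inj_on circulant_family (set family_table)"
    by (simp add: disjoint_family_on_iff_disjoint_image)
  then show ?disj ?card
    using family_table_props(3,4) by (simp_all add: card_image distinct_card)
qed

section \<open>Assembly of the eleven rows and the count of families\<close>

theorem theorem5p2:
  shows "(\<forall>l\<ge>1. realized12 (sym_circulant12 (4 * l) l l 0 l l 0) 3 (4 * l) 9 (16 * l) (4 * l) (2 * l) (6 * l)) \<and>
    (\<forall>l\<ge>1. realized12 (sym_circulant12 (3 * l) l 0 l 0 l (3 * l)) 4 (6 * l) 4 (9 * l) (3 * l) (2 * l) (8 * l)) \<and>
    (\<forall>l\<ge>1. realized12 (sym_circulant12 (5 * l) l l l l l (5 * l)) 4 (8 * l) 5 (15 * l) (5 * l) (4 * l) (12 * l)) \<and>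
    (\<forall>l\<ge>1. realized12 (sym_circulant12 (4 * l) l l (2 * l) l l 0) 4 (4 * l) 8 (12 * l) (4 * l) (4 * l) (8 * l)) \<and>
    (\<forall>l\<ge>1. realized12 (sym_circulant12 (3 * l) l l l 0 l l) 4 (3 * l) 8 (9 * l) (3 * l) (3 * l) (6 * l)) \<and>
    (\<forall>l\<ge>1. realized12 (sym_circulant12 (2 * l) l l 0 l l (2 * l)) 6 (4 * l) 3 (4 * l) (2 * l) (4 * l) (8 * l)) \<and>
    (\<forall>l\<ge>1. realized12 (sym_circulant12 (3 * l) l l l (3 * l) l l) 6 (6 * l) 3 (6 * l) (3 * l) (6 * l) (12 * l)) \<and>
    (\<forall>l\<ge>1. realized12 (sym_circulant12 (5 * l) (2 * l) (2 * l) (2 * l) (2 * l) (2 * l) (5 * l)) 6 (6 * l) 5 (10 * l) (5 * l) (12 * l) (18 * l)) \<and>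
    (\<forall>l\<ge>2. realized12 (sym_circulant12 (2 * l) l l l l l 0) 6 (2 * l) 6 (4 * l) (2 * l) (5 * l) (7 * l)) \<and>
    (\<forall>l\<ge>1. realized12 (sym_circulant12 (7 * l) (3 * l) (4 * l) (3 * l) (4 * l) (3 * l) l) 6 (6 * l) 7 (14 * l) (7 * l) (18 * l) (24 * l)) \<and>
    (\<forall>l\<ge>1. realized12 (sym_circulant12 (6 * l) (3 * l) (3 * l) (2 * l) (3 * l) (3 * l) (2 * l)) 6 (4 * l) 9 (12 * l) (6 * l) (16 * l) (20 * l)) \<and>
    (let \<F> =
      {{sym_circulant12 (4 * l) l l 0 l l 0 | l. l \<ge> 1},
       {sym_circulant12 (3 * l) l 0 l 0 l (3 * l) | l. l \<ge> 1},
       {sym_circulant12 (5 * l) l l l l l (5 * l) | l. l \<ge> 1},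
       {sym_circulant12 (4 * l) l l (2 * l) l l 0 | l. l \<ge> 1},
       {sym_circulant12 (3 * l) l l l 0 l l | l. l \<ge> 1},
       {sym_circulant12 (2 * l) l l 0 l l (2 * l) | l. l \<ge> 1},
       {sym_circulant12 (3 * l) l l l (3 * l) l l | l. l \<ge> 1},
       {sym_circulant12 (5 * l) (2 * l) (2 * l) (2 * l) (2 * l) (2 * l) (5 * l) | l. l \<ge> 1},
       {sym_circulant12 (2 * l) l l l l l 0 | l. l \<ge> 2},
       {sym_circulant12 (7 * l) (3 * l) (4 * l) (3 * l) (4 * l) (3 * l) l | l. l \<ge> 1},
       {sym_circulant12 (6 * l) (3 * l) (3 * l) (2 * l) (3 * l) (3 * l) (2 * l) | l. l \<ge> 1}}
     in card \<F> = 11 \<and> disjoint \<F> \<and>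
        (\<forall>F \<in> \<F>. infinite F \<and>
           (\<forall>M \<in> F. sym_integral_circulant 12 M \<and> is_pgd_concurrence_matrix M)))"
proof -
  have spec1: "mset (circulant12_eigenvalues (int 4) (int 1) (int 1) (int 0) (int 1) (int 0)) =
      mset (int (3 * 4) # replicate 9 (int 4) @ replicate (11 - 9) 0)"
    by code_simp
  have row1: "\<forall>l\<ge>1. realized12 (sym_circulant12 (4 * l) l l 0 l l 0) 3 (4 * l) 9 (16 * l) (4 * l) (2 * l) (6 * l)"
    using realized12I[OF circulant_design_multiples[OF design_row_1] spec1] by simp
  have spec2: "mset (circulant12_eigenvalues (int 3) (int 1) (int 0) (int 1) (int 0) (int 3)) =
      mset (int (4 * 3) # replicate 4 (int 6) @ replicate (11 - 4) 0)"
    by code_simp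
  have row2: "\<forall>l\<ge>1. realized12 (sym_circulant12 (3 * l) l 0 l 0 l (3 * l)) 4 (6 * l) 4 (9 * l) (3 * l) (2 * l) (8 * l)"
    using realized12I[OF circulant_design_multiples[OF design_row_2] spec2] by simp
  have spec3: "mset (circulant12_eigenvalues (int 5) (int 1) (int 1) (int 1) (int 1) (int 5)) =
      mset (int (4 * 5) # replicate 5 (int 8) @ replicate (11 - 5) 0)"
    by code_simp
  have row3: "\<forall>l\<ge>1. realized12 (sym_circulant12 (5 * l) l l l l l (5 * l)) 4 (8 * l) 5 (15 * l) (5 * l) (4 * l) (12 * l)"
    using realized12I[OF circulant_design_multiples[OF design_row_3] spec3] by simp
  have spec4: "mset (circulant12_eigenvalues (int 4) (int 1) (int 1) (int 2) (int 1) (int 0)) =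
      mset (int (4 * 4) # replicate 8 (int 4) @ replicate (11 - 8) 0)"
    by code_simp
  have row4: "\<forall>l\<ge>1. realized12 (sym_circulant12 (4 * l) l l (2 * l) l l 0) 4 (4 * l) 8 (12 * l) (4 * l) (4 * l) (8 * l)"
    using realized12I[OF circulant_design_multiples[OF design_row_4] spec4] by simp
  have spec5: "mset (circulant12_eigenvalues (int 3) (int 1) (int 1) (int 1) (int 0) (int 1)) =
      mset (int (4 * 3) # replicate 8 (int 3) @ replicate (11 - 8) 0)"
    by code_simp
  have row5: "\<forall>l\<ge>1. realized12 (sym_circulant12 (3 * l) l l l 0 l l) 4 (3 * l) 8 (9 * l) (3 * l) (3 * l) (6 * l)"
    using realized12I[OF circulant_design_multiples[OF design_row_5] spec5] by simp
  have spec6: "mset (circulant12_eigenvalues (int 2) (int 1) (int 1) (int 0) (int 1) (int 2)) =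
      mset (int (6 * 2) # replicate 3 (int 4) @ replicate (11 - 3) 0)"
    by code_simp
  have row6: "\<forall>l\<ge>1. realized12 (sym_circulant12 (2 * l) l l 0 l l (2 * l)) 6 (4 * l) 3 (4 * l) (2 * l) (4 * l) (8 * l)"
    using realized12I[OF circulant_design_multiples[OF design_row_6] spec6] by simp
  have spec7: "mset (circulant12_eigenvalues (int 3) (int 1) (int 1) (int 1) (int 3) (int 1)) =
      mset (int (6 * 3) # replicate 3 (int 6) @ replicate (11 - 3) 0)"
    by code_simp
  have row7: "\<forall>l\<ge>1. realized12 (sym_circulant12 (3 * l) l l l (3 * l) l l) 6 (6 * l) 3 (6 * l) (3 * l) (6 * l) (12 * l)"
    using realized12I[OF circulant_design_multiples[OF design_row_7] spec7] by simp
  have spec8: "mset (circulant12_eigenvalues (int 5) (int 2) (int 2) (int 2) (int 2) (int 5)) =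
      mset (int (6 * 5) # replicate 5 (int 6) @ replicate (11 - 5) 0)"
    by code_simp
  have row8: "\<forall>l\<ge>1. realized12 (sym_circulant12 (5 * l) (2 * l) (2 * l) (2 * l) (2 * l) (2 * l) (5 * l)) 6 (6 * l) 5 (10 * l) (5 * l) (12 * l) (18 * l)"
    using realized12I[OF circulant_design_multiples[OF design_row_8] spec8] by simp
  \<comment> \<open>The unscaled row serves here only for the spectrum; the designs start from the
    two multipliers 2 and 3.\<close>
  have spec9: "mset (circulant12_eigenvalues (int 2) (int 1) (int 1) (int 1) (int 1) (int 0)) =
      mset (int (6 * 2) # replicate 6 (int 2) @ replicate (11 - 6) 0)"
    by code_simp
  have row9: "\<forall>l\<ge>2. realized12 (sym_circulant12 (2 * l) l l l l l 0) 6 (2 * l) 6 (4 * l) (2 * l) (5 * l) (7 * l)"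
    using realized12I[OF circulant_design_multiples_2_3[OF design_row_9_2 design_row_9_3] spec9] by simp
  have spec10: "mset (circulant12_eigenvalues (int 7) (int 3) (int 4) (int 3) (int 4) (int 1)) =
      mset (int (6 * 7) # replicate 7 (int 6) @ replicate (11 - 7) 0)"
    by code_simp
  have row10: "\<forall>l\<ge>1. realized12 (sym_circulant12 (7 * l) (3 * l) (4 * l) (3 * l) (4 * l) (3 * l) l) 6 (6 * l) 7 (14 * l) (7 * l) (18 * l) (24 * l)"
    using realized12I[OF circulant_design_multiples[OF design_row_10] spec10] by simp
  have spec11: "mset (circulant12_eigenvalues (int 6) (int 3) (int 3) (int 2) (int 3) (int 2)) =
      mset (int (6 * 6) # replicate 9 (int 4) @ replicate (11 - 9) 0)"
    by code_simp
  have row11: "\<forall>l\<ge>1. realized12 (sym_circulant12 (6 * l) (3 * l) (3 * l) (2 * l) (3 * l) (3 * l) (2 * l)) 6 (4 * l) 9 (12 * l) (6 * l) (16 * l) (20 * l)"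
    using realized12I[OF circulant_design_multiples[OF design_row_11] spec11] by simp
  note rows = row1 row2 row3 row4 row5 row6 row7 row8 row9 row10 row11
  let ?F = "{{sym_circulant12 (4 * l) l l 0 l l 0 | l. l \<ge> 1},
       {sym_circulant12 (3 * l) l 0 l 0 l (3 * l) | l. l \<ge> 1},
       {sym_circulant12 (5 * l) l l l l l (5 * l) | l. l \<ge> 1},
       {sym_circulant12 (4 * l) l l (2 * l) l l 0 | l. l \<ge> 1},
       {sym_circulant12 (3 * l) l l l 0 l l | l. l \<ge> 1},
       {sym_circulant12 (2 * l) l l 0 l l (2 * l) | l. l \<ge> 1},
       {sym_circulant12 (3 * l) l l l (3 * l) l l | l. l \<ge> 1},
       {sym_circulant12 (5 * l) (2 * l) (2 * l) (2 * l) (2 * l) (2 * l) (5 * l) | l. l \<ge> 1},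
       {sym_circulant12 (2 * l) l l l l l 0 | l. l \<ge> 2},
       {sym_circulant12 (7 * l) (3 * l) (4 * l) (3 * l) (4 * l) (3 * l) l | l. l \<ge> 1},
       {sym_circulant12 (6 * l) (3 * l) (3 * l) (2 * l) (3 * l) (3 * l) (2 * l) | l. l \<ge> 1}}"
  \<comment> \<open>Identifying the explicit collection with the image of the table transfers
    cardinality, disjointness and infinitude to it.\<close>
  have F: "?F = circulant_family ` set family_table"
    by (simp add: family_table_def circulant_family_sym)
  have good: "\<forall>F \<in> ?F. \<forall>M \<in> F. sym_integral_circulant 12 M \<and> is_pgd_concurrence_matrix M"
    using rows realized12_imp_sym_integral_circulant by fast
  show ?thesis
    unfolding Let_def ball_conj_distrib
    by (intro conjI rows family_table_disjoint[folded F]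
        good[unfolded ball_conj_distrib, THEN conjunct1]
        good[unfolded ball_conj_distrib, THEN conjunct2])
qed

end
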